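(* Let $n$ be a positive integer and let $F_n$ be the set of rational numbers $a/b$ with integers $0\le a\le b\le n$, $b\ge1$, $\gcd(a,b)=1$. Suppose $S\subseteq F_n$ and $\mathcal{Q}(S)=F_n$. Then $S=\{0,1,\frac12,\frac13,\ldots,\frac1n\}$ or $S=\{0,1,\frac1n,\frac2n,\ldots,\frac{n-1}{n}\}$.
   Context: For a set $S$ of real numbers, $\mathcal{Q}(S)=\{x/y : x,y\in S,\ x\le y,\ y\neq 0\}$; by convention, if $S=\{0\}$ then $\mathcal{Q}(S)=\{0\}$. *)

theory Defs
  imports Complex_Main
begin

(* For S = {0} the comprehension would be empty; the first branch is the stated convention. *)
definition quotient_set :: "real set \<Rightarrow> real set" where
  "quotient_set S =
     (if S = {0} then {0} else {x / y | x y. x \<in> S \<and> y \<in> S \<and> x \<le> y \<and> y \<noteq> 0})"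

definition farey :: "nat \<Rightarrow> real set" where
  "farey n =
     {of_int a / of_int b | a b :: int. 0 \<le> a \<and> a \<le> b \<and> b \<le> int n \<and> 1 \<le> b \<and> coprime a b}"

end

theory Submission
  imports Defs
begin

text \<open>
  Put \<open>T = S - {0}\<close>. Since no positive element of \<open>F\<^sub>n\<close> is below \<open>1/n\<close>, realising \<open>1/n\<close> forces
  \<open>1, 1/n \<in> T\<close>, and realising \<open>1/(n-1)\<close> forces \<open>1/(n-1) \<in> T\<close> or \<open>(n-1)/n \<in> T\<close>. The involution
  \<open>x \<mapsto> 1/(n x)\<close> preserves the hypotheses and exchanges these two cases, so suppose
  \<open>1/(n-1) \<in> T\<close>. Comparing \<open>c/d \<in> T\<close>, \<open>1/2 < c/d < 1\<close>, with \<open>1/n\<close> and \<open>1/(n-1)\<close> gives \<open>c \<le> gcd d n\<close> and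
  \<open>c \<le> gcd d (n-1)\<close>, hence \<open>c\<^sup>2 \<le> d < 2 c\<close>, which is absurd as \<open>c \<ge> 2\<close>: so \<open>1\<close> is the only element of \<open>T\<close> above \<open>1/2\<close>.
  Realising \<open>1/m\<close> for \<open>m > n/2\<close> then forces \<open>1/m \<in> T\<close>. Finally, for \<open>n \<ge> 3\<close>, every positive \<open>b \<le> n\<close> is coprime to
  some such \<open>m\<close>: comparing \<open>a/b \<in> T\<close> with \<open>1/m\<close> gives \<open>a m \<le> n\<close>, so \<open>a = 1\<close>, and realising
  \<open>k/m\<close> with unit fractions gives \<open>1/k \<in> T\<close>.
\<close>

section \<open>Bounds on Farey fractions, and coprime numbers above \<open>n/2\<close>\<close>

lemma farey_posE:
  assumes "x \<in> farey n" "0 < x"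
  obtains a b :: nat where "0 < a" "a \<le> b" "b \<le> n" "coprime a b" "x = real a / real b"
proof -
  obtain a b :: int where ab: "0 \<le> a" "a \<le> b" "b \<le> int n" "1 \<le> b" "coprime a b"
      "x = of_int a / of_int b"
    using assms(1) by (auto simp: farey_def)
  have "a \<noteq> 0"
    using ab assms(2) by auto
  have "coprime (nat a) (nat b)"
    using ab by (simp add: coprime_int_iff [symmetric])
  then show thesis
    using ab \<open>a \<noteq> 0\<close> by (intro that [of "nat a" "nat b"]) auto
qed

lemma farey_ratioI:
  fixes a b :: nat
  assumes "a \<le> b" "b \<le> n" "0 < b" "coprime a b"
  shows "real a / real b \<in> farey n"
  unfolding farey_def using assms
  by (intro CollectI exI [of _ "int a"] exI [of _ "int b"]) auto

lemma farey_one_divI: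
  assumes "1 \<le> m" "m \<le> n"
  shows "1 / real m \<in> farey n"
  using farey_ratioI [of 1 m n] assms by simp

lemma farey_ge:
  assumes "x \<in> farey n" "0 < x"
  shows "1 / real n \<le> x"
proof -
  obtain a b :: nat where ab: "0 < a" "a \<le> b" "b \<le> n" "x = real a / real b"
    using assms by (rule farey_posE)
  then show ?thesis
    using frac_le [of "real a" 1 "real b" "real n"] by simp
qed

lemma farey_le_1: "x \<in> farey n \<Longrightarrow> x \<le> 1"
  by (auto simp: farey_def)

text \<open>In lowest terms \<open>p/q\<close> has denominator \<open>q / gcd p q\<close>, and
  membership in \<open>farey n\<close> bounds this by \<open>n\<close>.\<close>

lemma farey_denominator_le:
  fixes p q :: nat
  assumes "real p / real q \<in> farey n" "0 < p" "0 < q"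
  shows "q \<le> n * gcd p q"
proof -
  obtain a b :: nat where ab: "0 < a" "a \<le> b" "b \<le> n" "real p / real q = real a / real b"
    using assms by (elim farey_posE) auto
  have "real (p * b) = real (a * q)"
    using ab assms by (simp add: field_simps)
  then have "p * b = a * q"
    by (simp only: of_nat_eq_iff)
  \<comment> \<open>This gcd equals \<open>gcd p q * b\<close>, which brings in the bound on
    \<open>b\<close>.\<close>
  then have "q dvd gcd (p * b) (q * b)"
    by simp
  then have "q dvd gcd p q * b"
    by (metis gcd_mult_distrib_nat mult.commute)
  then have "q \<le> gcd p q * b"
    using ab assms by (intro dvd_imp_le) auto
  also have "\<dots> \<le> n * gcd p q"
    using ab by simp
  finally show ?thesis .
qed

lemma ex_coprime_above_half:
  fixes n k :: nat
  assumes "3 \<le> n" "1 \<le> k" "k \<le> n"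
  obtains m where "n < 2 * m" "m \<le> n" "coprime k m"
proof -
  consider "2 * k \<le> n" | "n < 2 * k" "k < n" | "k = n"
    using assms by linarith
  then show thesis
  proof cases
    case 1
    \<comment> \<open>The largest number up to \<open>n\<close> that is 1 modulo \<open>k\<close>;
      it exceeds \<open>n - k\<close>, which is at least \<open>n/2\<close>.\<close>
    define m where "m = n - (n - 1) mod k"
    have "(n - 1) mod k < k"
      using assms by simp
    moreover have "m = 1 + k * ((n - 1) div k)"
      using assms mult_div_mod_eq [of k "n - 1"] unfolding m_def by linarith
    then have "coprime k m"
      by (metis add.commute coprime_iff_gcd_eq_1 gcd_1_nat gcd_add_mult mult.commute)
    ultimately show thesis
      using 1 by (intro that [of m]) (auto simp: m_def)
  next
    case 2
    then show thesis
      by (intro that [of "k + 1"]) (auto simp: coprime_Suc_right_nat)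
  next
    case 3
    \<comment> \<open>Here \<open>3 \<le> n\<close> is what puts \<open>n - 1\<close> above
      \<open>n/2\<close>.\<close>
    have "coprime (n - 1) n"
      using assms coprime_Suc_right_nat [of "n - 1"] by simp
    then show thesis
      using 3 assms by (intro that [of "n - 1"]) (auto simp: coprime_commute)
  qed
qed

section \<open>The positive elements of \<open>S\<close>: extremal quotients and duality\<close>

locale farey_quotients =
  fixes n :: nat and T :: "real set"
  assumes n_pos: "1 \<le> n"
    and pos: "x \<in> T \<Longrightarrow> 0 < x"
    and in_farey: "x \<in> T \<Longrightarrow> x \<in> farey n"
    and quotient_in_farey: "\<lbrakk>x \<in> T; y \<in> T; x \<le> y\<rbrakk> \<Longrightarrow> x / y \<in> farey n"
    and realised: "\<lbrakk>f \<in> farey n; 0 < f\<rbrakk> \<Longrightarrow> \<exists>x\<in>T. \<exists>y\<in>T. f = x / y"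
begin

text \<open>The smaller term \<open>x\<close> is at least \<open>1/n\<close>, hence the bound on
  \<open>y\<close>; for \<open>m\<close> near \<open>n\<close> it pins \<open>y\<close> close to
  1.\<close>

lemma realise_one_div:
  assumes "1 \<le> m" "m \<le> n"
  obtains x y where "x \<in> T" "y \<in> T" "y = real m * x" "real m / real n \<le> y"
proof -
  have "1 / real m \<in> farey n"
    using assms by (rule farey_one_divI)
  moreover have "0 < 1 / real m"
    using assms by simp
  ultimately obtain x y where xy: "x \<in> T" "y \<in> T" "1 / real m = x / y"
    using realised by blast
  have "y = real m * x"
    using xy pos [of x] pos [of y] assms by (simp add: field_simps)
  moreover have "1 / real n \<le> x"
    using farey_ge in_farey pos xy by blast
  then have "real m / real n \<le> real m * x"
    using mult_left_mono [of "1 / real n" x "real m"] by simp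
  ultimately show thesis
    using that xy by metis
qed

lemma one_in: "1 \<in> T" and one_div_n_in: "1 / real n \<in> T"
proof -
  obtain x y where xy: "x \<in> T" "y \<in> T" "y = real n * x" "real n / real n \<le> y"
    using realise_one_div [of n] n_pos by auto
  have "y = 1"
    using xy farey_le_1 [OF in_farey [of y]] n_pos by simp
  with xy show "1 \<in> T" by simp
  have "x = 1 / real n"
    using xy \<open>y = 1\<close> n_pos by (simp add: field_simps)
  with xy show "1 / real n \<in> T" by simp
qed

text \<open>The larger term lies between \<open>(n-1)/n\<close> and 1, and no fraction with
  denominator at most \<open>n\<close> lies strictly between these.\<close>

lemma pred_dichotomy:
  assumes "2 \<le> n"
  shows "1 / real (n - 1) \<in> T \<or> real (n - 1) / real n \<in> T"
proof -
  obtain x y where xy: "x \<in> T" "y \<in> T" "y = real (n - 1) * x" "real (n - 1) / real n \<le> y"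
    using realise_one_div [of "n - 1"] assms by (metis One_nat_def Suc_1 diff_le_mono diff_le_self diff_Suc_1)
  obtain a b :: nat where ab: "0 < a" "a \<le> b" "b \<le> n" "y = real a / real b"
    using farey_posE [OF in_farey pos] xy by metis
  show ?thesis
  proof (cases "a = b")
    case True
    then have "x = 1 / real (n - 1)"
      using xy ab assms by (simp add: field_simps)
    then show ?thesis using xy by simp
  next
    case False
    have "real (n - 1) * real b \<le> real a * real n"
      using xy(4) ab assms by (simp add: field_simps)
    then have "(n - 1) * b \<le> a * n"
      by (simp only: of_nat_mult [symmetric] of_nat_le_iff)
    moreover have "a * n \<le> (b - 1) * n"
      using False ab by simp
    ultimately have "n * b - b \<le> n * b - n"
      by (simp add: algebra_simps)
    \<comment> \<open>Both subtrahends are at most \<open>n * b\<close>, so nothing is truncated and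
      \<open>n \<le> b\<close> follows.\<close>
    then have "b = n"
      using ab assms mult_le_mono2 [of 1 b n] mult_le_mono1 [of 1 n b] by linarith
    moreover have "n - 1 \<le> a"
      using \<open>(n - 1) * b \<le> a * n\<close> \<open>b = n\<close> assms by simp
    ultimately have "a = n - 1"
      using False ab by simp
    then show ?thesis
      using \<open>b = n\<close> ab xy by simp
  qed
qed

text \<open>The quotient of \<open>1/m\<close> by \<open>a/b\<close> is \<open>b/(a m)\<close>,
  whose terms have gcd \<open>gcd b m\<close> because \<open>a\<close> is coprime to
  \<open>b\<close>.\<close>

lemma compare_one_div:
  fixes a b m :: nat
  assumes "real a / real b \<in> T" "coprime a b" "0 < a" "0 < b"
    and "1 / real m \<in> T" "0 < m" "b \<le> a * m"
  shows "a * m \<le> n * gcd b m"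
proof -
  have "real b \<le> real (a * m)"
    using assms(7) by (simp only: of_nat_le_iff)
  then have "1 / real m \<le> real a / real b"
    using assms by (simp add: field_simps)
  then have "(1 / real m) / (real a / real b) \<in> farey n"
    using quotient_in_farey assms by blast
  then have "real b / real (a * m) \<in> farey n"
    by (simp add: mult.commute)
  then have "a * m \<le> n * gcd b (a * m)"
    using assms by (intro farey_denominator_le) auto
  moreover have "gcd b (a * m) = gcd b m"
    using assms(2) by (simp add: gcd_mult_right_left_cancel coprime_commute [of b a])
  ultimately show ?thesis by simp
qed

text \<open>The map reverses order and turns \<open>t/u\<close> into \<open>u/t\<close>, so the same
  quotients occur; each image is the quotient of \<open>1/n\<close> by an element of
  \<open>T\<close>.\<close>

lemma dual: "farey_quotients n ((\<lambda>x. 1 / (real n * x)) ` T)"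
proof
  show "1 \<le> n" by (rule n_pos)
next
  fix x assume "x \<in> (\<lambda>x. 1 / (real n * x)) ` T"
  then obtain t where t: "t \<in> T" "x = 1 / (real n * t)" by blast
  show "0 < x"
    using t pos n_pos by simp
  have "1 / real n \<le> t"
    using t farey_ge in_farey pos by blast
  then have "(1 / real n) / t \<in> farey n"
    using quotient_in_farey one_div_n_in t by blast
  then show "x \<in> farey n"
    using t by simp
next
  fix x y
  assume "x \<in> (\<lambda>x. 1 / (real n * x)) ` T" "y \<in> (\<lambda>x. 1 / (real n * x)) ` T" "x \<le> y"
  then obtain t u where tu: "t \<in> T" "u \<in> T" "x = 1 / (real n * t)" "y = 1 / (real n * u)"
    by blast
  have p: "0 < t" "0 < u" "0 < real n"
    using tu pos n_pos by auto
  have "u \<le> t"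
    using \<open>x \<le> y\<close> tu p by (simp add: field_simps)
  moreover have "x / y = u / t"
    unfolding tu(3,4) using p by (simp add: field_simps)
  ultimately show "x / y \<in> farey n"
    using quotient_in_farey tu by simp
next
  fix f assume "f \<in> farey n" "0 < f"
  then obtain t u where tu: "t \<in> T" "u \<in> T" "f = t / u"
    using realised by blast
  have "0 < t" "0 < u" "0 < real n"
    using tu pos n_pos by auto
  then have "f = (1 / (real n * u)) / (1 / (real n * t))"
    unfolding tu(3) by (simp add: field_simps)
  then show "\<exists>x\<in>(\<lambda>x. 1 / (real n * x)) ` T. \<exists>y\<in>(\<lambda>x. 1 / (real n * x)) ` T. f = x / y"
    using tu by blast
qed

section \<open>The case \<open>1/(n-1) \<in> T\<close>: unit fractions\<close>

context
  assumes n_ge_2: "2 \<le> n" and one_div_pred_in: "1 / real (n - 1) \<in> T"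
begin

lemma above_half_eq_1:
  assumes "y \<in> T" "1 / 2 < y"
  shows "y = 1"
proof (rule ccontr)
  assume "y \<noteq> 1"
  obtain c d :: nat where cd: "0 < c" "c \<le> d" "d \<le> n" "coprime c d" "y = real c / real d"
    using farey_posE [OF in_farey pos] assms(1) by metis
  have "c \<noteq> d"
    using \<open>y \<noteq> 1\<close> cd by auto
  have "real d < real (2 * c)"
    using assms(2) cd by (simp add: field_simps)
  then have "d < 2 * c"
    by (simp only: of_nat_less_iff)
  then have "2 \<le> c" "3 \<le> n"
    using cd \<open>c \<noteq> d\<close> by linarith+
  have "d \<le> c * n"
    using cd by (metis le_trans mult_le_mono1 Suc_leI One_nat_def mult_1)
  then have "c * n \<le> n * gcd d n"
    using compare_one_div [of c d n] assms(1) cd one_div_n_in n_pos by simp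
  then have c1: "c \<le> gcd d n"
    using n_pos by (simp add: mult.commute)
  \<comment> \<open>Ensures \<open>1/(n-1) \<le> c/d\<close>, since
    \<open>d \<le> n \<le> 2 (n-1)\<close>.\<close>
  have "2 * (n - 1) \<le> c * (n - 1)"
    using \<open>2 \<le> c\<close> by simp
  then have "d \<le> c * (n - 1)"
    using cd n_ge_2 by linarith
  then have *: "c * (n - 1) \<le> n * gcd d (n - 1)"
    using compare_one_div [of c d "n - 1"] assms(1) cd one_div_pred_in n_ge_2 by simp
  \<comment> \<open>The factors \<open>n - 1\<close> and \<open>n\<close> in the comparison do not
    cancel: if \<open>c\<close> exceeded the gcd, the gcd would be all of \<open>n - 1\<close>,
    forcing \<open>n \<le> c\<close>.\<close>
  have c2: "c \<le> gcd d (n - 1)"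
  proof (rule ccontr)
    assume less: "\<not> ?thesis"
    then have "(gcd d (n - 1) + 1) * (n - 1) \<le> c * (n - 1)"
      by (intro mult_le_mono1) simp
    also have "\<dots> \<le> ((n - 1) + 1) * gcd d (n - 1)"
      using * n_ge_2 by simp
    finally have "n - 1 \<le> gcd d (n - 1)"
      by (simp only: add_mult_distrib mult.commute [of "n - 1"] add_le_cancel_left mult_1)
    moreover have "gcd d (n - 1) \<le> n - 1"
      using n_ge_2 by (intro gcd_le2_nat) auto
    ultimately have "gcd d (n - 1) = n - 1" by simp
    then have "n \<le> c"
      using less by simp
    then show False
      using cd \<open>c \<noteq> d\<close> by simp
  qed
  \<comment> \<open>Makes the two gcds coprime divisors of \<open>d\<close>, so that their product
    is at most \<open>d\<close>.\<close>
  have "coprime n (n - 1)"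
    using n_ge_2 coprime_Suc_left_nat [of "n - 1"] by simp
  then have "coprime (gcd d n) (gcd d (n - 1))"
    by (meson coprime_divisors gcd_dvd2)
  then have "gcd d n * gcd d (n - 1) dvd d"
    by (simp add: divides_mult)
  then have "gcd d n * gcd d (n - 1) \<le> d"
    using cd by (intro dvd_imp_le) auto
  then have "c * c \<le> d"
    using mult_le_mono [OF c1 c2] by simp
  moreover have "2 * c \<le> c * c"
    using \<open>2 \<le> c\<close> by simp
  ultimately show False
    using \<open>d < 2 * c\<close> by simp
qed

text \<open>As \<open>m/n\<close> exceeds \<open>1/2\<close>, the larger term of the quotient
  realising \<open>1/m\<close> can only be 1.\<close>

lemma one_div_large_in:
  assumes "n < 2 * m" "m \<le> n"
  shows "1 / real m \<in> T"
proof -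
  have "1 \<le> m"
    using assms by simp
  then obtain x y where xy: "x \<in> T" "y \<in> T" "y = real m * x" "real m / real n \<le> y"
    using realise_one_div assms by metis
  have "1 / 2 < real m / real n"
    using assms n_pos by (simp add: field_simps)
  then have "y = 1"
    using above_half_eq_1 [OF xy(2)] xy(4) by linarith
  then have "x = 1 / real m"
    using xy \<open>1 \<le> m\<close> by (simp add: field_simps)
  then show ?thesis using xy by simp
qed

text \<open>For \<open>m\<close> coprime to the denominator the comparison has gcd 1, giving
  \<open>a m \<le> n < 2 m\<close>.\<close>

lemma is_unit_fraction:
  assumes "x \<in> T"
  obtains k where "1 \<le> k" "k \<le> n" "x = 1 / real k"
proof -
  obtain a b :: nat where ab: "0 < a" "a \<le> b" "b \<le> n" "coprime a b" "x = real a / real b"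
    using farey_posE [OF in_farey pos] assms by metis
  have "a = 1"
  proof (rule ccontr)
    assume "a \<noteq> 1"
    then have "2 \<le> a" using ab by simp
    then have "a \<noteq> b" using ab by auto
    then have "3 \<le> n" using \<open>2 \<le> a\<close> ab by simp
    then obtain m where m: "n < 2 * m" "m \<le> n" "coprime b m"
      using ex_coprime_above_half [of n b] ab by auto
    have "a * m \<le> n"
    proof (cases "b \<le> a * m")
      case True
      then have "a * m \<le> n * gcd b m"
        using compare_one_div [of a b m] assms ab m one_div_large_in by simp
      then show ?thesis using m by (simp add: coprime_iff_gcd_eq_1)
    next
      case False
      then show ?thesis using ab by simp
    qed
    moreover have "2 * m \<le> a * m"
      using \<open>2 \<le> a\<close> by simp
    ultimately show False using m by simp
  qed
  then show thesis
    using ab by (intro that [of b]) auto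
qed

lemma one_div_in:
  assumes "1 \<le> k" "k \<le> n"
  shows "1 / real k \<in> T"
proof -
  consider "k = 1" | "n < 2 * k" | "2 \<le> k" "2 * k \<le> n"
    using assms by linarith
  then show ?thesis
  proof cases
    case 1
    then show ?thesis using one_in by simp
  next
    case 2
    then show ?thesis using one_div_large_in assms by simp
  next
    case 3
    then obtain m where m: "n < 2 * m" "m \<le> n" "coprime k m"
      using ex_coprime_above_half [of n k] by auto
    \<comment> \<open>Here \<open>k < m\<close>, as \<open>2 k \<le> n < 2 m\<close>. Realised as
      \<open>(1/i)/(1/j)\<close>, this fraction yields \<open>m dvd i\<close>; then
      \<open>i \<le> n < 2 m\<close> leaves only \<open>i = m\<close> and
      \<open>j = k\<close>.\<close>
    then have "real k / real m \<in> farey n"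
      using 3 by (intro farey_ratioI) auto
    moreover have "0 < real k / real m"
      using 3 m by simp
    ultimately obtain x y where xy: "x \<in> T" "y \<in> T" "real k / real m = x / y"
      using realised by blast
    obtain i where i: "1 \<le> i" "i \<le> n" "x = 1 / real i"
      using is_unit_fraction xy by metis
    obtain j where j: "1 \<le> j" "j \<le> n" "y = 1 / real j"
      using is_unit_fraction xy by metis
    have "real (k * i) = real (j * m)"
      using xy i j m by (simp add: field_simps)
    then have eq: "k * i = j * m"
      by (simp only: of_nat_eq_iff)
    then have "m dvd k * i" by simp
    then have "m dvd i"
      using m by (simp add: coprime_dvd_mult_right_iff coprime_commute)
    then obtain q where q: "i = m * q" by blast
    have "q = 1"
    proof (rule ccontr)
      assume "q \<noteq> 1"
      then have "2 \<le> q" using q i by (cases q) auto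
      then have "m * 2 \<le> m * q" by simp
      then show False using q i(2) m(1) by linarith
    qed
    then have "j = k"
      using eq q i by simp
    then show ?thesis using xy j by simp
  qed
qed

lemma eq_unit_fractions: "T = {1 / real k | k. 1 \<le> k \<and> k \<le> n}"
  using is_unit_fraction one_div_in by blast

end

section \<open>Combining the two dual cases\<close>

lemma classification:
  "T = {1 / real k | k. 1 \<le> k \<and> k \<le> n} \<or> T = {real k / real n | k. 1 \<le> k \<and> k \<le> n}"
proof (cases "n = 1")
  case True
  have "x = 1" if "x \<in> T" for x
    using farey_ge [OF in_farey pos] farey_le_1 [OF in_farey] that True by force
  then have "T = {1}"
    using one_in by blast
  also have "{1} = {1 / real k | k. 1 \<le> k \<and> k \<le> n}"
    using True by force
  finally show ?thesis by simp
next
  case False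
  then have n2: "2 \<le> n" using n_pos by simp
  let ?d = "\<lambda>x. 1 / (real n * x)"
  interpret D: farey_quotients n "?d ` T" by (rule dual)
  show ?thesis
  proof (cases "1 / real (n - 1) \<in> T")
    case True
    then show ?thesis using eq_unit_fractions n2 by simp
  next
    case False
    then have "real (n - 1) / real n \<in> T"
      using pred_dichotomy n2 by simp
    moreover have "1 / real (n - 1) = ?d (real (n - 1) / real n)"
      using n2 by simp
    ultimately have "1 / real (n - 1) \<in> ?d ` T" by blast
    then have eq: "?d ` T = {1 / real k | k. 1 \<le> k \<and> k \<le> n}"
      using D.eq_unit_fractions n2 by simp
    \<comment> \<open>The map is an involution, so \<open>T\<close> is recovered by sending each
      \<open>1/k\<close> to \<open>k/n\<close>.\<close>
    have "T = ?d ` ?d ` T"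
      using n_pos by (simp add: image_image)
    also have "\<dots> = ?d ` {1 / real k | k. 1 \<le> k \<and> k \<le> n}"
      by (simp only: eq)
    also have "\<dots> = {?d (1 / real k) | k. 1 \<le> k \<and> k \<le> n}" by blast
    also have "\<dots> = {real k / real n | k. 1 \<le> k \<and> k \<le> n}" by simp
    finally show ?thesis by simp
  qed
qed

end

section \<open>Restoring the element 0\<close>

theorem theorem3:
  fixes n :: nat and S :: "real set"
  assumes "n \<ge> 1"
    and "S \<subseteq> farey n"
    and "quotient_set S = farey n"
  shows "S = {0, 1} \<union> {1 / real k | k. 2 \<le> k \<and> k \<le> n}
       \<or> S = {0, 1} \<union> {real k / real n | k. 1 \<le> k \<and> k < n}"
proof -
  have "1 \<in> farey n"
    using farey_one_divI [of 1 n] assms(1) by simp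
  \<comment> \<open>The conventional value \<open>{0}\<close> of the quotient set misses 1.\<close>
  then have "S \<noteq> {0}"
    unfolding assms(3) [symmetric] by (auto simp: quotient_set_def)
  then have Q: "farey n = {x / y | x y. x \<in> S \<and> y \<in> S \<and> x \<le> y \<and> y \<noteq> 0}"
    using assms(3) by (simp add: quotient_set_def)
  have nonneg: "0 \<le> x" if "x \<in> S" for x
    using that assms(2) by (auto simp: farey_def)
  have "0 \<in> farey n"
    using farey_ratioI [of 0 1 n] assms(1) by simp
  \<comment> \<open>A quotient with nonzero denominator vanishes only if its numerator is 0.\<close>
  then have "0 \<in> S"
    unfolding Q by auto
  interpret farey_quotients n "S - {0}"
  proof
    show "1 \<le> n" by (rule assms(1))
    show "0 < x" if "x \<in> S - {0}" for x
      using that nonneg [of x] by auto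
    show "x \<in> farey n" if "x \<in> S - {0}" for x
      using that assms(2) by auto
    show "x / y \<in> farey n" if "x \<in> S - {0}" "y \<in> S - {0}" "x \<le> y" for x y
      unfolding Q using that by blast
    show "\<exists>x\<in>S - {0}. \<exists>y\<in>S - {0}. f = x / y" if f: "f \<in> farey n" "0 < f" for f
    proof -
      obtain x y where "x \<in> S" "y \<in> S" "y \<noteq> 0" "f = x / y"
        using f(1) unfolding Q by blast
      then show ?thesis using f(2) by force
    qed
  qed
  have unit: "{1 / real k | k. 1 \<le> k \<and> k \<le> n} = {1} \<union> {1 / real k | k. 2 \<le> k \<and> k \<le> n}"
  proof -
    have "{k. 1 \<le> k \<and> k \<le> n} = {1} \<union> {k. 2 \<le> k \<and> k \<le> n}"
      using assms(1) by auto
    then have "(\<lambda>k. 1 / real k) ` {k. 1 \<le> k \<and> k \<le> n}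
        = (\<lambda>k. 1 / real k) ` ({1} \<union> {k. 2 \<le> k \<and> k \<le> n})"
      by simp
    then show ?thesis by (simp add: image_Un setcompr_eq_image)
  qed
  have multiple: "{real k / real n | k. 1 \<le> k \<and> k \<le> n} = {1} \<union> {real k / real n | k. 1 \<le> k \<and> k < n}"
  proof -
    have "{k. 1 \<le> k \<and> k \<le> n} = {n} \<union> {k. 1 \<le> k \<and> k < n}"
      using assms(1) by auto
    then have "(\<lambda>k. real k / real n) ` {k. 1 \<le> k \<and> k \<le> n}
        = (\<lambda>k. real k / real n) ` ({n} \<union> {k. 1 \<le> k \<and> k < n})"
      by simp
    then show ?thesis using assms(1) by (simp add: image_Un setcompr_eq_image)
  qed
  have "S = {0, 1} \<union> A" if "S - {0} = {1} \<union> A" for A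
    using that \<open>0 \<in> S\<close> by blast
  then show ?thesis
    using classification unfolding unit multiple by blast
qed

end
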